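(* Let $n\ge2$ and let $S\subseteq\mathbb N^n$ be a local good semigroup with conductor $\delta=(c[1],\dots,c[n])$. Let $$G=\mathrm{Small}(S)\cup\{(c[1]+1,c[2],\dots,c[n]),\dots,(c[1],\dots,c[i]+1,c[i+1],\dots,c[n]),\dots,(c[1],\dots,c[n-1],c[n]+1)\}.$$ Then $\mathrm{Arf}(S)=\mathrm{Arf}(G)$, i.e. the smallest Arf semigroup of $\mathbb N^n$ containing $S$ is the smallest Arf semigroup of $\mathbb N^n$ containing $G$.
   Context: $\mathbb N=\{0,1,2,\dots\}$; $v[i]$ is the $i$-th component of $v$; $\mathbb N^n$ has the componentwise partial order, and $\min(a,b)$ is the componentwise minimum. A good semigroup $S$ of $\mathbb N^n$ is a submonoid of $(\mathbb N^n,+)$ such that: (i) $\min(a,b)\in S$ for all $a,b\in S$; (ii) if $a\neq b$ in $S$ and $a[i]=b[i]$ for some $i$, then there is $c\in S$ with $c[i]>a[i]=b[i]$, $c[j]\ge\min(a[j],b[j])$ for $j\ne i$, and $c[j]=\min(a[j],b[j])$ whenever $a[j]\ne b[j]$; (iii) there is $\delta\in S$ with $\delta+\mathbb N^n\subseteq S$. It is local if the zero vector is the only element of $S$ with some component equal to zero. An Arf semigroup of $\mathbb N^n$ is here a local good semigroup $S$ such that $S(\alpha)-\alpha$ is a semigroup for each $\alpha\in S$, where $S(\alpha)=\{\beta\in S:\beta\ge\alpha\}$. For a subset $G\subseteq\mathbb N^n$, $\mathrm{Arf}(G)$ denotes the minimum, with respect to inclusion, of the set of Arf semigroups of $\mathbb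 N^n$ containing $G$ (when it exists); for a good semigroup $S$, $\mathrm{Arf}(S)$ is the smallest Arf semigroup containing $S$ (the Arf closure of $S$; its existence is known). The conductor of $S$ is the minimal vector $\delta$ such that $\delta+\mathbb N^n\subseteq S$, and $\mathrm{Small}(S)=\{\mathbf s\in S:\mathbf 0<\mathbf s\le\delta\}$ (the zero vector is not included). *)

theory Defs
  imports "HOL-Analysis.Finite_Cartesian_Product"
begin

text \<open>
  Elements of \<open>\<nat>\<^sup>n\<close> are vectors of type \<^typ>\<open>nat ^ 'n\<close>, with \<open>n = CARD('n)\<close>; the library order
  on this type is the componentwise partial order.
\<close>

definition vmin :: "nat ^ 'n \<Rightarrow> nat ^ 'n \<Rightarrow> nat ^ 'n" where
  "vmin a b = (\<chi> i. min (a $ i) (b $ i))"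

definition good_semigroup :: "(nat ^ 'n) set \<Rightarrow> bool" where
  "good_semigroup S \<longleftrightarrow>
     0 \<in> S \<and> (\<forall>a\<in>S. \<forall>b\<in>S. a + b \<in> S) \<and>
     (\<forall>a\<in>S. \<forall>b\<in>S. vmin a b \<in> S) \<and>
     (\<forall>a\<in>S. \<forall>b\<in>S. \<forall>i. a \<noteq> b \<and> a $ i = b $ i \<longrightarrow>
        (\<exists>c\<in>S. c $ i > a $ i \<and>
           (\<forall>j. j \<noteq> i \<longrightarrow> c $ j \<ge> min (a $ j) (b $ j)) \<and>
           (\<forall>j. a $ j \<noteq> b $ j \<longrightarrow> c $ j = min (a $ j) (b $ j)))) \<and>
     (\<exists>d\<in>S. \<forall>v. d + v \<in> S)"

definition local_semigroup :: "(nat ^ 'n) set \<Rightarrow> bool" where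
  "local_semigroup S \<longleftrightarrow> (\<forall>a\<in>S. (\<exists>i. a $ i = 0) \<longrightarrow> a = 0)"

definition upper_part :: "(nat ^ 'n) set \<Rightarrow> nat ^ 'n \<Rightarrow> (nat ^ 'n) set" where
  "upper_part S \<alpha> = {\<beta> \<in> S. \<beta> \<ge> \<alpha>}"

text \<open>The truncated subtraction on \<^typ>\<open>nat\<close> is only applied to \<open>\<beta> \<ge> \<alpha>\<close>, where it is exact.\<close>

definition arf_semigroup :: "(nat ^ 'n) set \<Rightarrow> bool" where
  "arf_semigroup S \<longleftrightarrow> good_semigroup S \<and> local_semigroup S \<and>
     (\<forall>\<alpha>\<in>S. \<forall>x\<in>(\<lambda>\<beta>. \<beta> - \<alpha>) ` upper_part S \<alpha>. \<forall>y\<in>(\<lambda>\<beta>. \<beta> - \<alpha>) ` upper_part S \<alpha>.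
        x + y \<in> (\<lambda>\<beta>. \<beta> - \<alpha>) ` upper_part S \<alpha>)"

definition is_arf_closure :: "(nat ^ 'n) set \<Rightarrow> (nat ^ 'n) set \<Rightarrow> bool" where
  "is_arf_closure G A \<longleftrightarrow>
     arf_semigroup A \<and> G \<subseteq> A \<and> (\<forall>T. arf_semigroup T \<and> G \<subseteq> T \<longrightarrow> A \<subseteq> T)"

text \<open>Meaningful only if a closure exists; see \<^const>\<open>is_arf_closure\<close>.\<close>

definition Arf :: "(nat ^ 'n) set \<Rightarrow> (nat ^ 'n) set" where
  "Arf G = (THE A. is_arf_closure G A)"

definition conductor :: "(nat ^ 'n) set \<Rightarrow> nat ^ 'n" where
  "conductor S = (LEAST d. \<forall>v. d + v \<in> S)"

definition Small :: "(nat ^ 'n) set \<Rightarrow> (nat ^ 'n) set" where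
  "Small S = {s \<in> S. 0 < s \<and> s \<le> conductor S}"

text \<open>For a good semigroup the least element in the definition of the conductor exists.\<close>

lemma conductor_least:
  fixes S :: "(nat ^ 'n) set"
  assumes "good_semigroup S"
  shows "conductor S + v \<in> S"
    and "(\<And>w. d + w \<in> S) \<Longrightarrow> conductor S \<le> d"
proof -
  define P where "P d \<longleftrightarrow> (\<forall>v. d + v \<in> S)" for d
  have vmin_S: "vmin a b \<in> S" if "a \<in> S" "b \<in> S" for a b
    using assms that unfolding good_semigroup_def by blast
  obtain e where e: "P e"
    using assms unfolding good_semigroup_def P_def by blast
  have P_vmin: "P (vmin a b)" if ab: "P a" "P b" for a b
    unfolding P_def
  proof
    fix v
    define x :: "nat ^ 'n" where "x = (\<chi> i. if a $ i \<le> b $ i then v $ i else v $ i + b $ i)"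
    define y :: "nat ^ 'n" where "y = (\<chi> i. if a $ i \<le> b $ i then v $ i + a $ i else v $ i)"
    have "vmin a b + v = vmin (a + x) (b + y)"
      by (auto simp: vec_eq_iff vmin_def x_def y_def min_def)
    then show "vmin a b + v \<in> S"
      using ab vmin_S unfolding P_def by metis
  qed
  define f :: "nat ^ 'n \<Rightarrow> nat" where "f d = (\<Sum>i\<in>UNIV. d $ i)" for d
  obtain m where m: "P m" and min_m: "\<And>d. P d \<Longrightarrow> f m \<le> f d"
    using ex_has_least_nat[of P e f] e by blast
  have le: "m \<le> d" if d: "P d" for d
  proof (rule ccontr)
    assume "\<not> m \<le> d"
    then obtain i where "d $ i < m $ i"
      by (auto simp: less_eq_vec_def not_le)
    then have "f (vmin m d) < f m"
      unfolding f_def by (intro sum_strict_mono_ex1) (auto simp: vmin_def intro!: exI[of _ i])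
    with min_m[OF P_vmin[OF m d]] show False
      by simp
  qed
  have "conductor S = m"
    unfolding conductor_def using m le by (intro Least_equality) (auto simp: P_def)
  with m le show "conductor S + v \<in> S" "(\<And>w. d + w \<in> S) \<Longrightarrow> conductor S \<le> d"
    by (auto simp: P_def)
qed

end

theory Submission
  imports Defs
begin

text \<open>
  The only good-semigroup axiom that is not obviously stable under intersection is (ii). In an Arf
  semigroup \<open>T\<close>, however, the witness for \<open>a\<close> and \<open>b\<close> can be chosen independently of \<open>T\<close>: the
  translate of \<open>T\<close> by \<open>m = min(a, b)\<close> is additively closed, so the witnesses belonging to the
  coordinates of \<open>F = {i. a[i] = b[i]}\<close> may be added up, multiplied and cut off at any fixed \<open>d\<close>
  with \<open>d + \<nat>\<^sup>n \<subseteq> T\<close>, which yields \<open>m + d 1\<^sub>F \<in> T\<close>. Hence Arf closures exist. Moreover an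
  Arf semigroup containing \<open>G\<close> contains \<open>\<delta> + \<nat>\<^sup>n\<close> by the Arf property at \<open>\<delta>\<close>, and then (ii)
  allows every coordinate that has reached \<open>\<delta>\<close> to be raised freely, so it contains \<open>S\<close>.
\<close>

section \<open>Vectors of naturals and translates of good semigroups\<close>

lemma vmin_nth [simp]: "vmin a b $ i = min (a $ i) (b $ i)"
  by (simp add: vmin_def)

lemma zero_le_vec_nat: "(0 :: nat ^ 'n) \<le> v"
  by (simp add: less_eq_vec_def)

lemma vec_nat_le_iff_add: "(a :: nat ^ 'n) \<le> b \<longleftrightarrow> (\<exists>x. b = a + x)"
proof
  assume "a \<le> b"
  then have "b = a + (b - a)"
    by (simp add: vec_eq_iff less_eq_vec_def)
  then show "\<exists>x. b = a + x" ..
qed (auto simp: less_eq_vec_def)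

lemma shifted_upper_part: "(\<lambda>\<beta>. \<beta> - \<alpha>) ` upper_part S \<alpha> = {x. \<alpha> + x \<in> S}"
proof -
  have "\<alpha> + x - \<alpha> = x" for x :: "nat ^ 'a"
    by (simp add: vec_eq_iff)
  then show ?thesis
    unfolding upper_part_def vec_nat_le_iff_add by (force simp: image_iff)
qed

text \<open>Recording an element above \<open>m\<close> as \<open>m + x\<close> turns the Arf
  condition into additive closure of the translate by \<open>m\<close>, free of truncated
  subtraction.\<close>

lemma arf_semigroup_iff:
  "arf_semigroup T \<longleftrightarrow> good_semigroup T \<and> local_semigroup T \<and>
     (\<forall>m x y. m \<in> T \<longrightarrow> m + x \<in> T \<longrightarrow> m + y \<in> T \<longrightarrow> m + (x + y) \<in> T)"
  unfolding arf_semigroup_def shifted_upper_part by blast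

lemma good_semigroupD:
  assumes "good_semigroup T"
  shows good_zero: "0 \<in> T"
    and good_add: "a \<in> T \<Longrightarrow> b \<in> T \<Longrightarrow> a + b \<in> T"
    and good_vmin: "a \<in> T \<Longrightarrow> b \<in> T \<Longrightarrow> vmin a b \<in> T"
  using assms unfolding good_semigroup_def by blast+

text \<open>The witness \<open>c\<close> dominates \<open>vmin a b\<close> in every coordinate, so
  it can be recorded by its difference \<open>x\<close>; in an Arf semigroup such differences may be
  added.\<close>

lemma good_witness:
  assumes "good_semigroup T" "a \<in> T" "b \<in> T" "a \<noteq> b" "a $ i = b $ i"
  obtains x where "vmin a b + x \<in> T" "x $ i > 0" "\<And>j. a $ j \<noteq> b $ j \<Longrightarrow> x $ j = 0"
proof -
  obtain c where c: "c \<in> T" "c $ i > a $ i" "\<And>j. j \<noteq> i \<Longrightarrow> c $ j \<ge> min (a $ j) (b $ j)"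
      "\<And>j. a $ j \<noteq> b $ j \<Longrightarrow> c $ j = min (a $ j) (b $ j)"
    using assms unfolding good_semigroup_def by blast
  have "vmin a b $ j \<le> c $ j" for j
    using c(2) c(3)[of j] assms(5) by (cases "j = i") auto
  then obtain x where x: "c = vmin a b + x"
    using vec_nat_le_iff_add less_eq_vec_def by metis
  show thesis
  proof
    show "vmin a b + x \<in> T" "x $ i > 0"
      using c(1,2) assms(5) by (auto simp: x)
    show "x $ j = 0" if "a $ j \<noteq> b $ j" for j
      using c(4)[OF that] by (simp add: x)
  qed
qed

section \<open>Witnesses common to all Arf semigroups\<close>

lemma arf_sum:
  assumes T: "arf_semigroup T" and m: "m \<in> T" and "finite A" and "\<And>k. k \<in> A \<Longrightarrow> m + w k \<in> T"
  shows "m + sum w A \<in> T"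
  using assms(3,4)
proof (induction A rule: finite_induct)
  case empty
  then show ?case using m by simp
next
  case (insert k A)
  then show ?case
    using T m unfolding arf_semigroup_iff by auto
qed

lemma arf_uniform_witness:
  fixes T :: "(nat ^ 'n) set"
  assumes T: "arf_semigroup T" and ab: "a \<in> T" "b \<in> T" "a \<noteq> b" and d: "\<And>v. d + v \<in> T"
  shows "vmin a b + (\<chi> j. if a $ j = b $ j then d $ j else 0) \<in> T"
proof -
  define F where "F = {i. a $ i = b $ i}"
  define m where "m = vmin a b"
  have good: "good_semigroup T"
    using T by (simp add: arf_semigroup_iff)
  have mT: "m \<in> T"
    using good_vmin[OF good] ab by (simp add: m_def)
  have "\<exists>x. m + x \<in> T \<and> x $ i > 0 \<and> (\<forall>j. j \<notin> F \<longrightarrow> x $ j = 0)" if "i \<in> F" for i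
  proof -
    have "a $ i = b $ i"
      using that by (simp add: F_def)
    from good_witness[OF good ab this] show ?thesis
      unfolding F_def m_def by (metis (mono_tags, lifting) mem_Collect_eq)
  qed
  then obtain w where w: "\<And>i. i \<in> F \<Longrightarrow> m + w i \<in> T" "\<And>i. i \<in> F \<Longrightarrow> w i $ i > 0"
      "\<And>i j. i \<in> F \<Longrightarrow> j \<notin> F \<Longrightarrow> w i $ j = 0"
    by metis
  \<comment> \<open>\<open>w i\<close> is positive at \<open>i\<close>, so \<open>d $ i\<close>
    copies of it reach \<open>d $ i\<close> there.\<close>
  define u where "u = (\<Sum>i\<in>F. \<Sum>k<d $ i. w i)"
  have uT: "m + u \<in> T"
    unfolding u_def by (intro arf_sum[OF T mT] w) auto
  have u_off: "u $ j = 0" if "j \<notin> F" for j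
    using w(3) that by (simp add: u_def)
  have u_on: "d $ j \<le> u $ j" if "j \<in> F" for j
  proof -
    have "d $ j \<le> d $ j * w j $ j"
      using w(2)[OF that] by simp
    also have "\<dots> = (\<Sum>k<d $ j. w j) $ j"
      by (subst sum_component) simp
    also have "\<dots> \<le> (\<Sum>i\<in>F. (\<Sum>k<d $ i. w i) $ j)"
      by (rule member_le_sum[OF that]) auto
    finally show ?thesis
      by (simp add: u_def)
  qed
  \<comment> \<open>The cut-off is at \<open>d + m\<close> rather than \<open>d\<close>: it leaves
    exactly \<open>m + d\<close> on \<open>F\<close> and does not disturb \<open>m\<close>
    elsewhere.\<close>
  have "vmin (m + u) (d + m) = m + (\<chi> j. if a $ j = b $ j then d $ j else 0)"
    using u_off u_on by (auto simp: vec_eq_iff F_def)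
  then show ?thesis
    using good_vmin[OF good uT d, of m] by (simp add: m_def)
qed

section \<open>Intersections and existence of the closure\<close>

lemma arf_Inter:
  fixes \<T> :: "(nat ^ 'n) set set"
  assumes ne: "\<T> \<noteq> {}" and arf: "\<And>T. T \<in> \<T> \<Longrightarrow> arf_semigroup T"
    and d: "\<And>T v. T \<in> \<T> \<Longrightarrow> d + v \<in> T"
  shows "arf_semigroup (\<Inter>\<T>)"
proof -
  have good: "good_semigroup T" if "T \<in> \<T>" for T
    using arf[OF that] by (simp add: arf_semigroup_iff)
  have witness: "\<exists>c\<in>\<Inter>\<T>. c $ i > a $ i \<and>
           (\<forall>j. j \<noteq> i \<longrightarrow> c $ j \<ge> min (a $ j) (b $ j)) \<and>
           (\<forall>j. a $ j \<noteq> b $ j \<longrightarrow> c $ j = min (a $ j) (b $ j))"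
    if ab: "a \<in> \<Inter>\<T>" "b \<in> \<Inter>\<T>" "a \<noteq> b" "a $ i = b $ i" for a b i
  proof -
    \<comment> \<open>\<open>d\<close> may vanish at \<open>i\<close>, hence the shift by \<open>1\<close>.\<close>
    define c where "c = vmin a b + (\<chi> j. if a $ j = b $ j then (d + 1) $ j else 0)"
    have "c \<in> T" if "T \<in> \<T>" for T
      unfolding c_def
      using ab that d[OF that] arf[OF that]
      by (intro arf_uniform_witness) (auto simp: add.assoc)
    then show ?thesis
      using ab(4) by (intro bexI[of _ c]) (auto simp: c_def)
  qed
  have "good_semigroup (\<Inter>\<T>)"
    unfolding good_semigroup_def
  proof (intro conjI ballI allI impI)
    show "\<exists>d\<in>\<Inter>\<T>. \<forall>v. d + v \<in> \<Inter>\<T>"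
      using d d[where v = 0] by (intro bexI[of _ d]) auto
  qed (use good good_zero good_add good_vmin witness in \<open>(blast | simp)+\<close>)
  moreover have "local_semigroup (\<Inter>\<T>)"
    using ne arf unfolding arf_semigroup_iff local_semigroup_def by blast
  ultimately show ?thesis
    using arf unfolding arf_semigroup_iff by blast
qed

text \<open>Every local \<open>S\<close> lies in this set, so some Arf semigroup contains
  \<open>S\<close> and the family to be intersected is nonempty.\<close>

lemma arf_zero_or_positive: "arf_semigroup ({0} \<union> {v :: nat ^ 'n. \<forall>i. v $ i > 0})"
proof -
  let ?T = "{0} \<union> {v :: nat ^ 'n. \<forall>i. v $ i > 0}"
  have "\<exists>c\<in>?T. c $ i > a $ i \<and>
           (\<forall>j. j \<noteq> i \<longrightarrow> c $ j \<ge> min (a $ j) (b $ j)) \<and>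
           (\<forall>j. a $ j \<noteq> b $ j \<longrightarrow> c $ j = min (a $ j) (b $ j))"
    if ab: "a \<in> ?T" "b \<in> ?T" "a \<noteq> b" "a $ i = b $ i" for a b i
  proof -
    \<comment> \<open>If one of them were zero, the common value at \<open>i\<close> would be 0 and
      the other would be zero too.\<close>
    have "\<forall>i. a $ i > 0" "\<forall>i. b $ i > 0"
      using ab by (auto, metis less_irrefl, metis less_irrefl zero_index)
    then show ?thesis
      using ab(4)
      by (intro bexI[of _ "vmin a b + (\<chi> j. if a $ j = b $ j then 1 else 0)"]) auto
  qed
  moreover have "vmin a b \<in> ?T" if "a \<in> ?T" "b \<in> ?T" for a b
    using that by (auto simp: vec_eq_iff)
  moreover have "\<exists>d\<in>?T. \<forall>v. d + v \<in> ?T"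
    by (intro bexI[of _ 1]) auto
  ultimately have "good_semigroup ?T"
    unfolding good_semigroup_def by auto
  moreover have "local_semigroup ?T"
    unfolding local_semigroup_def by (metis (mono_tags, lifting) UnE less_irrefl mem_Collect_eq singletonD)
  ultimately show ?thesis
    unfolding arf_semigroup_iff by auto
qed

lemma is_arf_closure_unique: "is_arf_closure G A \<Longrightarrow> is_arf_closure G B \<Longrightarrow> A = B"
  unfolding is_arf_closure_def by blast

lemma Arf_eq: "is_arf_closure G A \<Longrightarrow> Arf G = A"
  unfolding Arf_def by (metis is_arf_closure_unique the_equality)

lemma arf_closure_exists:
  assumes "good_semigroup S" "local_semigroup S"
  shows "\<exists>A. is_arf_closure S A"
proof -
  define \<T> where "\<T> = {T. arf_semigroup T \<and> S \<subseteq> T}"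
  obtain d where d: "\<And>v. d + v \<in> S"
    using assms(1) unfolding good_semigroup_def by blast
  have "S \<subseteq> {0} \<union> {v. \<forall>i. v $ i > 0}"
    using assms(2) unfolding local_semigroup_def by auto
  then have "\<T> \<noteq> {}"
    using arf_zero_or_positive unfolding \<T>_def by blast
  \<comment> \<open>Every member contains \<open>S\<close>, so the single \<open>d\<close> taken
    from \<open>S\<close> serves the whole family.\<close>
  then have "arf_semigroup (\<Inter>\<T>)"
    by (rule arf_Inter[where d = d]) (use d in \<open>auto simp: \<T>_def\<close>)
  then have "is_arf_closure S (\<Inter>\<T>)"
    unfolding is_arf_closure_def \<T>_def by blast
  then show ?thesis ..
qed

section \<open>Raising coordinates that have reached \<open>d\<close>\<close>

lemma good_raise_coordinate:
  fixes T :: "(nat ^ 'n) set"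
  assumes T: "good_semigroup T" and d: "\<And>v. d + v \<in> T" and t: "t \<in> T" "d $ i \<le> t $ i"
  shows "t + axis i 1 \<in> T"
proof -
  have above: "v \<in> T" if "d \<le> v" for v
    using that d unfolding vec_nat_le_iff_add by blast
  \<comment> \<open>Both vectors lie above \<open>d\<close>. Off \<open>i\<close>, \<open>b\<close>
    exceeds \<open>t\<close>, so the witness for \<open>t\<close> and \<open>b\<close> changes
    \<open>t\<close> only at \<open>i\<close>; the minimum with \<open>e\<close> trims that raise to
    one.\<close>
  define b where "b = (\<chi> j. if j = i then t $ i else max (d $ j) (t $ j) + 1)"
  define e where "e = (\<chi> j. if j = i then t $ i + 1 else max (d $ j) (t $ j))"
  have bT: "b \<in> T" and eT: "e \<in> T"
    using t(2) by (auto intro!: above simp: b_def e_def less_eq_vec_def)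
  show ?thesis
  proof (cases "t = b")
    case True \<comment> \<open>only possible in dimension one\<close>
    have "j = i" for j
      using arg_cong[OF True, of "\<lambda>v. v $ j"]
      by (auto simp: b_def max_def split: if_splits)
    then have "d $ j \<le> (t + axis i 1) $ j" for j
      using t(2) by (metis trans_le_add1 vector_add_component)
    then have "d \<le> t + axis i 1"
      by (simp add: less_eq_vec_def)
    then show ?thesis
      by (rule above)
  next
    case False
    have "t $ i = b $ i"
      by (simp add: b_def)
    then obtain x where x: "vmin t b + x \<in> T" "x $ i > 0" "\<And>j. t $ j \<noteq> b $ j \<Longrightarrow> x $ j = 0"
      using good_witness[OF T t(1) bT False] by blast
    have "vmin (vmin t b + x) e = t + axis i 1"
      unfolding vec_eq_iff
    proof
      fix j
      show "vmin (vmin t b + x) e $ j = (t + axis i 1) $ j"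
        using x(2) x(3)[of j] by (cases "j = i") (auto simp: b_def e_def axis_def)
    qed
    then show ?thesis
      using good_vmin[OF T x(1) eT] by simp
  qed
qed

text \<open>Climb from \<open>vmin s d\<close> to \<open>s\<close> by unit raises: a coordinate
  still short of \<open>s\<close> has already reached \<open>d\<close>, and raising preserves
  this.\<close>

lemma good_mem_of_vmin_mem:
  fixes T :: "(nat ^ 'n) set"
  assumes T: "good_semigroup T" and d: "\<And>v. d + v \<in> T" and "vmin s d \<in> T"
  shows "s \<in> T"
proof -
  have "t \<in> T \<Longrightarrow> t \<le> s \<Longrightarrow> (\<And>i. t $ i < s $ i \<Longrightarrow> d $ i \<le> t $ i) \<Longrightarrow> s \<in> T" for t
  proof (induction "\<Sum>i\<in>UNIV. s $ i - t $ i" arbitrary: t rule: less_induct)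
    case less
    show ?case
    proof (cases "t = s")
      case False
      then obtain i where i: "t $ i < s $ i"
        using less.prems(2) by (metis less_eq_vec_def nat_less_le vec_eq_iff)
      show ?thesis
      proof (rule less.hyps)
        show "t + axis i 1 \<in> T"
          using good_raise_coordinate[OF T d] less.prems(1,3) i by blast
        show "(\<Sum>j\<in>UNIV. s $ j - (t + axis i 1) $ j) < (\<Sum>j\<in>UNIV. s $ j - t $ j)"
          using i by (intro sum_strict_mono_ex1) (auto simp: axis_def intro!: exI[of _ i])
        show "t + axis i 1 \<le> s"
          using less.prems(2) i by (auto simp: less_eq_vec_def axis_def)
        show "d $ j \<le> (t + axis i 1) $ j" if "(t + axis i 1) $ j < s $ j" for j
          using less.prems(3)[of j] that by simp
      qed
    qed (use less.prems in simp)
  qed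
  from this[OF assms(3)] show ?thesis
    by (auto simp: less_eq_vec_def min_def split: if_splits)
qed

section \<open>Generators of the closure\<close>

lemma vec_nat_eq_sum_axis: "(v :: nat ^ 'n) = (\<Sum>i\<in>UNIV. \<Sum>k<v $ i. axis i 1)"
proof -
  have "(\<Sum>k<n. axis i 1) = (axis i n :: nat ^ 'n)" for n i
    by (induction n) (auto simp: vec_eq_iff axis_def)
  then show ?thesis
    by (simp only:) (simp add: vec_eq_iff axis_def)
qed

lemma arf_orthant:
  fixes T :: "(nat ^ 'n) set"
  assumes "arf_semigroup T" "d \<in> T" "\<And>i. d + axis i 1 \<in> T"
  shows "d + v \<in> T"
  by (subst vec_nat_eq_sum_axis[of v]) (intro arf_sum assms finite; simp)

text \<open>Both sets thus have the same Arf supersets, so the closure of \<open>S\<close> is also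
  that of the generators, and existence carries over.\<close>

lemma arf_contains_iff_contains_generators:
  fixes S T :: "(nat ^ 'n) set"
  assumes S: "good_semigroup S" and T: "arf_semigroup T"
  shows "Small S \<union> {conductor S + axis i 1 | i. True} \<subseteq> T \<longleftrightarrow> S \<subseteq> T"
proof
  let ?d = "conductor S"
  assume G: "Small S \<union> {?d + axis i 1 | i. True} \<subseteq> T"
  have goodT: "good_semigroup T"
    using T by (simp add: arf_semigroup_iff)
  \<comment> \<open>\<open>Small S\<close> omits the zero vector, which \<open>T\<close> contains as
    a monoid.\<close>
  have small: "s \<in> T" if "s \<in> S" "s \<le> ?d" for s
  proof (cases "s = 0")
    case True
    then show ?thesis using good_zero[OF goodT] by simp
  next
    case False
    then have "s \<in> Small S"
      using that zero_le_vec_nat[of s] by (simp add: Small_def)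
    then show ?thesis using G by blast
  qed
  have dS: "?d \<in> S"
    using conductor_least(1)[OF S, of 0] by simp
  have dT: "?d + v \<in> T" for v
    by (rule arf_orthant[OF T small[OF dS order_refl]]) (use G in blast)
  have vminT: "vmin s ?d \<in> T" if "s \<in> S" for s
    using good_vmin[OF S that dS] by (intro small) (auto simp: less_eq_vec_def)
  show "S \<subseteq> T"
    using good_mem_of_vmin_mem[OF goodT dT vminT] ..
next
  assume "S \<subseteq> T"
  then show "Small S \<union> {conductor S + axis i 1 | i. True} \<subseteq> T"
    using conductor_least(1)[OF S] by (auto simp: Small_def)
qed

theorem mainTheorem5:
  fixes S G :: "(nat ^ 'n) set"
  assumes "CARD('n) \<ge> 2"
    and "good_semigroup S" and "local_semigroup S"
    and "G = Small S \<union> {conductor S + axis i 1 | i. True}"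
  shows "is_arf_closure S (Arf S) \<and> is_arf_closure G (Arf G) \<and> Arf S = Arf G"
proof -
  obtain A where A: "is_arf_closure S A"
    using arf_closure_exists[OF assms(2,3)] by blast
  have "is_arf_closure G A"
    using A arf_contains_iff_contains_generators[OF assms(2)]
    unfolding is_arf_closure_def assms(4) by blast
  with A show ?thesis
    by (simp add: Arf_eq)
qed

end
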